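(* For all integers $n\geq 0$: (1) $|\mathcal{DDP}_{2n+1}| = 2^{2n+2}+5\cdot 2^{n+1}-(2n^2+9n+12)$; (2) $|\mathcal{DDP}_{2n}| = 2^{2n+1}+7\cdot 2^n-(2n^2+7n+8)$.
   Context: For an integer $k\ge 0$, $X_k=\{1,2,\ldots,k\}$ (with $X_0=\emptyset$) and $\mathcal{I}_k$ is the symmetric inverse semigroup of all partial one-to-one maps of $X_k$ (including the empty map), with maps written on the right of their arguments. A map $\alpha\in\mathcal{I}_k$ is a partial isometry if $|x-y|=|x\alpha-y\alpha|$ for all $x,y\in\operatorname{Dom}\alpha$; it is order-decreasing if $x\alpha\leq x$ for all $x\in\operatorname{Dom}\alpha$. $\mathcal{DDP}_k$ is the semigroup of all order-decreasing partial isometries of $X_k$. *)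

theory Defs
  imports Main
begin

definition X_set :: "nat \<Rightarrow> nat set" where
  "X_set k = {1..k}"

text \<open>A partial map of \<open>X_set k\<close> is a map \<open>nat \<rightharpoonup> nat\<close> that is undefined outside \<open>X_set k\<close>, so distinct
  elements of the set below are distinct partial maps of \<open>X_set k\<close>.\<close>

definition sym_inv_semigroup :: "nat \<Rightarrow> (nat \<rightharpoonup> nat) set" where
  "sym_inv_semigroup k = {\<alpha>. dom \<alpha> \<subseteq> X_set k \<and> ran \<alpha> \<subseteq> X_set k \<and> inj_on \<alpha> (dom \<alpha>)}"

text \<open>Distances are taken in \<open>int\<close> because subtraction on \<open>nat\<close> truncates.\<close>

definition partial_isometry :: "(nat \<rightharpoonup> nat) \<Rightarrow> bool" where
  "partial_isometry \<alpha> \<longleftrightarrow>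
     (\<forall>x \<in> dom \<alpha>. \<forall>y \<in> dom \<alpha>. \<bar>int x - int y\<bar> = \<bar>int (the (\<alpha> x)) - int (the (\<alpha> y))\<bar>)"

definition order_decreasing :: "(nat \<rightharpoonup> nat) \<Rightarrow> bool" where
  "order_decreasing \<alpha> \<longleftrightarrow> (\<forall>x \<in> dom \<alpha>. the (\<alpha> x) \<le> x)"

definition DDP :: "nat \<Rightarrow> (nat \<rightharpoonup> nat) set" where
  "DDP k = {\<alpha> \<in> sym_inv_semigroup k. order_decreasing \<alpha> \<and> partial_isometry \<alpha>}"

end

theory Submission
  imports Defs
begin

text \<open>
  Once its domain and the image of a single point are known, a partial isometry of a chain can only
  be the restriction of one of two maps: a translation or a reflection. It is convenient to take
  for this point the largest element \<open>t\<close> of the domain. If \<open>t\<close> goes to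
  \<open>t - d\<close>, then either every \<open>x\<close> goes to \<open>x - d\<close>, or every
  \<open>x\<close> goes to \<open>2 * t - d - x\<close>; a mixture is impossible because
  \<open>t\<close> dominates the domain, so that a translated point and a reflected point would
  end up too far apart (\<open>top_fibre_eq\<close>).

  What remains free is the domain. A translation by \<open>d\<close> keeps positive values exactly on
  \<open>{Suc d..t}\<close>; the reflection is order-decreasing exactly on \<open>{t - d div 2..t}\<close>. Each domain has to
  contain \<open>t\<close>, which leaves \<open>2 ^ (t - 1 - d)\<close> translations and \<open>2 ^ (d div 2)\<close> reflections, and the
  two families share only the map with domain \<open>{t}\<close>. Since every order-decreasing map that avoids
  \<open>t\<close> in its domain also avoids \<open>t\<close> in its range, summation over \<open>d\<close> gives the growth of the
  cardinality from \<open>t - 1\<close> to \<open>t\<close> (\<open>card_DDP_Suc\<close>). The floor in \<open>d div 2\<close> is what makes the closed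
  form depend on the parity.
\<close>

section \<open>Isometries with a prescribed image of the top point\<close>

definition top_fibre :: "nat \<Rightarrow> nat \<Rightarrow> (nat \<rightharpoonup> nat) set" where
  "top_fibre t d = {\<alpha> \<in> DDP t. \<alpha> t = Some (t - d)}"

definition subsets_with_top :: "nat \<Rightarrow> nat \<Rightarrow> nat set set" where
  "subsets_with_top a t = {S. S \<subseteq> {a..t} \<and> t \<in> S}"

definition graph_on :: "(nat \<Rightarrow> nat) \<Rightarrow> nat set \<Rightarrow> (nat \<rightharpoonup> nat)" where
  "graph_on f S = (\<lambda>x. Some (f x)) |` S"

definition top_translations :: "nat \<Rightarrow> nat \<Rightarrow> (nat \<rightharpoonup> nat) set" where
  "top_translations t d = graph_on (\<lambda>x. x - d) ` subsets_with_top (Suc d) t"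

definition top_reflections :: "nat \<Rightarrow> nat \<Rightarrow> (nat \<rightharpoonup> nat) set" where
  "top_reflections t d = graph_on (\<lambda>x. 2 * t - d - x) ` subsets_with_top (t - d div 2) t"

lemma dom_graph_on [simp]: "dom (graph_on f S) = S"
  by (auto simp: graph_on_def restrict_map_def dom_def)

lemma graph_on_apply [simp]: "x \<in> S \<Longrightarrow> graph_on f S x = Some (f x)"
  by (simp add: graph_on_def)

lemma ran_graph_on [simp]: "ran (graph_on f S) = f ` S"
  by (auto simp: graph_on_def ran_def restrict_map_def)

lemma graph_on_eqI:
  assumes "\<And>x. x \<in> dom \<alpha> \<Longrightarrow> \<alpha> x = Some (f x)"
  shows "\<alpha> = graph_on f (dom \<alpha>)"
  using assms by (auto simp: graph_on_def restrict_map_def dom_def fun_eq_iff)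

lemma inj_on_graph_on: "inj_on (graph_on f) A"
  by (metis dom_graph_on inj_onI)

lemma partial_isometry_imp_inj_on:
  assumes "partial_isometry \<alpha>"
  shows "inj_on \<alpha> (dom \<alpha>)"
proof (rule inj_onI)
  fix x y assume "x \<in> dom \<alpha>" "y \<in> dom \<alpha>" "\<alpha> x = \<alpha> y"
  with assms have "\<bar>int x - int y\<bar> = 0" by (simp add: partial_isometry_def)
  then show "x = y" by simp
qed

lemma graph_on_in_DDP:
  assumes "S \<subseteq> {1..t}"
    and "\<And>x. x \<in> S \<Longrightarrow> 1 \<le> f x \<and> f x \<le> x"
    and "\<And>x y. x \<in> S \<Longrightarrow> y \<in> S \<Longrightarrow> \<bar>int x - int y\<bar> = \<bar>int (f x) - int (f y)\<bar>"
  shows "graph_on f S \<in> DDP t"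
proof -
  have iso: "partial_isometry (graph_on f S)"
    using assms(3) by (simp add: partial_isometry_def)
  have "f x \<in> {1..t}" if "x \<in> S" for x
    using assms(1) assms(2)[OF that] that by force
  then have "f ` S \<subseteq> {1..t}" by blast
  then show ?thesis
    using assms(1,2) iso partial_isometry_imp_inj_on[OF iso]
    by (simp add: DDP_def sym_inv_semigroup_def X_set_def order_decreasing_def)
qed

lemma DDP_D:
  assumes "\<alpha> \<in> DDP t" and "\<alpha> x = Some y"
  shows "1 \<le> y" "x \<le> t" "y \<le> x"
proof -
  have "x \<in> dom \<alpha>" "y \<in> ran \<alpha>" using assms(2) by (auto intro: ranI)
  moreover have "dom \<alpha> \<subseteq> {1..t}" "ran \<alpha> \<subseteq> {1..t}" and dec: "order_decreasing \<alpha>"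
    using assms(1) by (simp_all add: DDP_def sym_inv_semigroup_def X_set_def)
  ultimately show "1 \<le> y" "x \<le> t" by auto
  show "y \<le> x"
    using dec \<open>x \<in> dom \<alpha>\<close> assms(2) unfolding order_decreasing_def by (metis option.sel)
qed

lemma DDP_dist:
  assumes "\<alpha> \<in> DDP t" "\<alpha> x = Some x'" "\<alpha> y = Some y'"
  shows "\<bar>int x - int y\<bar> = \<bar>int x' - int y'\<bar>"
proof -
  have "x \<in> dom \<alpha>" "y \<in> dom \<alpha>" using assms(2,3) by auto
  moreover have "partial_isometry \<alpha>" using assms(1) by (simp add: DDP_def)
  ultimately have "\<bar>int x - int y\<bar> = \<bar>int (the (\<alpha> x)) - int (the (\<alpha> y))\<bar>"
    by (simp only: partial_isometry_def)
  then show ?thesis using assms(2,3) by simp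
qed

text \<open>
  The distance to \<open>t\<close> leaves two candidates for the image of each point. Since \<open>t\<close> is the largest
  point, a translated \<open>x\<close> and a reflected \<open>y\<close> have images on opposite sides of \<open>t - d\<close>, at distance
  \<open>(t - x) + (t - y)\<close>, which exceeds the distance of \<open>x\<close> and \<open>y\<close> unless one of them is \<open>t\<close>.
\<close>

lemma top_fibre_eq:
  assumes "d < t"
  shows "top_fibre t d = top_translations t d \<union> top_reflections t d"
proof (intro equalityI subsetI)
  fix \<alpha> assume "\<alpha> \<in> top_fibre t d"
  then have D: "\<alpha> \<in> DDP t" and top: "\<alpha> t = Some (t - d)" by (auto simp: top_fibre_def)
  have t_dom: "t \<in> dom \<alpha>" using top by auto
  have cand: "y + d = x \<or> x + y + d = 2 * t" if "\<alpha> x = Some y" for x y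
  proof -
    have "int (t - d) = int t - int d" using assms by simp
    then show ?thesis
      using DDP_dist[OF D that top] DDP_D(2)[OF D that] by linarith
  qed
  show "\<alpha> \<in> top_translations t d \<union> top_reflections t d"
  proof (cases "\<forall>x y. \<alpha> x = Some y \<longrightarrow> y + d = x")
    case True
    have "y = x - d" if "\<alpha> x = Some y" for x y
      using True that by fastforce
    then have "\<alpha> = graph_on (\<lambda>x. x - d) (dom \<alpha>)"
      by (intro graph_on_eqI) auto
    moreover have "dom \<alpha> \<subseteq> {Suc d..t}"
      using True DDP_D[OF D] by fastforce
    ultimately show ?thesis
      using t_dom by (auto simp: top_translations_def subsets_with_top_def)
  next
    case False
    \<comment> \<open>A single point that is not translated forces the reflection at every other point.\<close>
    then obtain y y' where y: "\<alpha> y = Some y'" "y' + d \<noteq> y" by blast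
    have refl: "x + x' + d = 2 * t" if "\<alpha> x = Some x'" for x x'
    proof (rule ccontr)
      assume "\<not> ?thesis"
      then have "int x' = int x - int d" "x \<noteq> t" using cand[OF that] by linarith+
      moreover have "int y' = 2 * int t - int d - int y" "y \<noteq> t"
        using cand[OF y(1)] y(2) by linarith+
      moreover have "x \<le> t" "y \<le> t" using DDP_D[OF D] that y(1) by blast+
      ultimately show False using DDP_dist[OF D that y(1)] by linarith
    qed
    have "x' = 2 * t - d - x" if "\<alpha> x = Some x'" for x x'
      using refl[OF that] by linarith
    then have "\<alpha> = graph_on (\<lambda>x. 2 * t - d - x) (dom \<alpha>)"
      by (intro graph_on_eqI) auto
    moreover have "dom \<alpha> \<subseteq> {t - d div 2..t}"
    proof
      fix x assume "x \<in> dom \<alpha>"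
      then obtain x' where x': "\<alpha> x = Some x'" by auto
      show "x \<in> {t - d div 2..t}"
        using refl[OF x'] DDP_D[OF D x'] by (simp add: le_diff_conv)
    qed
    ultimately show ?thesis
      using t_dom by (auto simp: top_reflections_def subsets_with_top_def)
  qed
next
  fix \<alpha> assume "\<alpha> \<in> top_translations t d \<union> top_reflections t d"
  then consider
      S where "S \<subseteq> {Suc d..t}" "t \<in> S" "\<alpha> = graph_on (\<lambda>x. x - d) S"
    | S where "S \<subseteq> {t - d div 2..t}" "t \<in> S" "\<alpha> = graph_on (\<lambda>x. 2 * t - d - x) S"
    by (auto simp: top_translations_def top_reflections_def subsets_with_top_def)
  then show "\<alpha> \<in> top_fibre t d"
  proof cases
    case 1
    have bd: "d < x" "x \<le> t" if "x \<in> S" for x using 1(1) that by fastforce+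
    have "\<alpha> \<in> DDP t"
      unfolding 1(3)
    proof (rule graph_on_in_DDP)
      show "S \<subseteq> {1..t}" using bd by fastforce
      show "1 \<le> x - d \<and> x - d \<le> x" if "x \<in> S" for x using bd[OF that] by simp
      show "\<bar>int x - int y\<bar> = \<bar>int (x - d) - int (y - d)\<bar>" if "x \<in> S" "y \<in> S" for x y
        using bd(1)[OF that(1)] bd(1)[OF that(2)] by (simp add: of_nat_diff)
    qed
    then show ?thesis using 1 by (simp add: top_fibre_def)
  next
    case 2
    have bd: "t \<le> x + d div 2" "x \<le> t" if "x \<in> S" for x
      using 2(1) that by fastforce+
    have bd2: "2 * t \<le> 2 * x + d" if "x \<in> S" for x
      using bd(1)[OF that] by linarith
    have "\<alpha> \<in> DDP t"
      unfolding 2(3)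
    proof (rule graph_on_in_DDP)
      show "S \<subseteq> {1..t}"
      proof
        fix x assume "x \<in> S"
        with bd2[OF this] bd(2)[OF this] assms show "x \<in> {1..t}" by simp
      qed
      show "1 \<le> 2 * t - d - x \<and> 2 * t - d - x \<le> x" if "x \<in> S" for x
        using bd[OF that] bd2[OF that] assms by linarith
      show "\<bar>int x - int y\<bar> = \<bar>int (2 * t - d - x) - int (2 * t - d - y)\<bar>"
        if "x \<in> S" "y \<in> S" for x y
      proof -
        have "int (2 * t - d - z) = 2 * int t - int d - int z" if "z \<in> S" for z
          using bd(2)[OF that] assms by linarith
        then show ?thesis using that by simp
      qed
    qed
    then show ?thesis using 2 by (simp add: top_fibre_def)
  qed
qed

section \<open>Counting\<close>

lemma subsets_with_top_eq:
  assumes "a \<le> t"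
  shows "subsets_with_top a t = insert t ` Pow {a..<t}"
proof (intro equalityI subsetI)
  fix S assume "S \<in> subsets_with_top a t"
  then have "S = insert t (S - {t})" "S - {t} \<in> Pow {a..<t}"
    by (auto simp: subsets_with_top_def order_less_le)
  then show "S \<in> insert t ` Pow {a..<t}" by blast
next
  fix S assume "S \<in> insert t ` Pow {a..<t}"
  then show "S \<in> subsets_with_top a t"
    using assms by (fastforce simp: subsets_with_top_def)
qed

lemma finite_subsets_with_top: "finite (subsets_with_top a t)"
  by (rule finite_subset[of _ "Pow {a..t}"]) (auto simp: subsets_with_top_def)

lemma card_subsets_with_top:
  assumes "a \<le> t"
  shows "card (subsets_with_top a t) = 2 ^ (t - a)"
proof -
  have "inj_on (insert t) (Pow {a..<t})"
    by (rule inj_onI) (metis Pow_iff atLeastLessThan_iff insert_ident less_irrefl subsetD)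
  then show ?thesis
    by (simp add: subsets_with_top_eq[OF assms] card_image card_Pow)
qed

text \<open>A point \<open>x\<close> with \<open>x - d = 2 * t - d - x\<close> must be \<open>t\<close> itself.\<close>

lemma translations_Int_reflections:
  assumes "d < t"
  shows "top_translations t d \<inter> top_reflections t d = {graph_on (\<lambda>x. x - d) {t}}"
proof (intro equalityI subsetI)
  fix \<alpha> assume "\<alpha> \<in> top_translations t d \<inter> top_reflections t d"
  then obtain S S' where
    S: "S \<subseteq> {Suc d..t}" "t \<in> S" "\<alpha> = graph_on (\<lambda>x. x - d) S" and
    S': "S' \<subseteq> {t - d div 2..t}" "\<alpha> = graph_on (\<lambda>x. 2 * t - d - x) S'"
    by (auto simp: top_translations_def top_reflections_def subsets_with_top_def)
  have "S' = S" using S(3) S'(2) by (metis dom_graph_on)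
  have "x = t" if "x \<in> S" for x
  proof -
    have "x - d = 2 * t - d - x"
      using that S(3) S'(2) \<open>S' = S\<close> by (metis graph_on_apply option.inject)
    moreover have "d < x" "x \<le> t" using that S(1) by fastforce+
    ultimately show ?thesis by linarith
  qed
  then have "S = {t}" using S(2) by blast
  then show "\<alpha> \<in> {graph_on (\<lambda>x. x - d) {t}}" using S(3) by simp
next
  fix \<alpha> assume \<alpha>: "\<alpha> \<in> {graph_on (\<lambda>x. x - d) {t}}"
  have "{t} \<in> subsets_with_top (Suc d) t" "{t} \<in> subsets_with_top (t - d div 2) t"
    using assms by (auto simp: subsets_with_top_def)
  moreover have "graph_on (\<lambda>x. x - d) {t} = graph_on (\<lambda>x. 2 * t - d - x) {t}"
    by (auto simp: graph_on_def restrict_map_def)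
  ultimately show "\<alpha> \<in> top_translations t d \<inter> top_reflections t d"
    using \<alpha> unfolding top_translations_def top_reflections_def by blast
qed

lemma finite_top_fibre:
  assumes "d < t"
  shows "finite (top_fibre t d)"
  by (simp add: top_fibre_eq[OF assms] top_translations_def top_reflections_def finite_subsets_with_top)

lemma card_top_fibre:
  assumes "d < t"
  shows "int (card (top_fibre t d)) = 2 ^ (t - 1 - d) + 2 ^ (d div 2) - 1"
proof -
  have T: "card (top_translations t d) = 2 ^ (t - 1 - d)"
    using assms by (simp add: top_translations_def card_image inj_on_graph_on card_subsets_with_top)
  have R: "card (top_reflections t d) = 2 ^ (d div 2)"
  proof -
    have "t - (t - d div 2) = d div 2" using assms by linarith
    then show ?thesis
      by (simp add: top_reflections_def card_image inj_on_graph_on card_subsets_with_top)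
  qed
  have "finite (top_translations t d)" "finite (top_reflections t d)"
    by (simp_all add: top_translations_def top_reflections_def finite_subsets_with_top)
  then have "card (top_translations t d) + card (top_reflections t d) = card (top_fibre t d) + 1"
    using card_Un_Int[of "top_translations t d" "top_reflections t d"]
    by (simp add: top_fibre_eq[OF assms] translations_Int_reflections[OF assms])
  then have "2 ^ (t - 1 - d) + 2 ^ (d div 2) = card (top_fibre t d) + 1"
    unfolding T R .
  then have "int (2 ^ (t - 1 - d) + 2 ^ (d div 2)) = int (card (top_fibre t d) + 1)"
    by (simp only:)
  then show ?thesis by simp
qed

lemma DDP_0: "DDP 0 = {Map.empty}"
  by (auto simp: DDP_def sym_inv_semigroup_def X_set_def order_decreasing_def partial_isometry_def)

text \<open>
  Because the maps are order-decreasing, only \<open>Suc k\<close> itself can be mapped to \<open>Suc k\<close>, so that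
  a map undefined at \<open>Suc k\<close> has its range in \<open>{1..k}\<close> as well.
\<close>

lemma DDP_Suc: "DDP (Suc k) = DDP k \<union> (\<Union>d\<in>{..k}. top_fibre (Suc k) d)"
proof (intro equalityI subsetI)
  fix \<alpha> assume D: "\<alpha> \<in> DDP (Suc k)"
  show "\<alpha> \<in> DDP k \<union> (\<Union>d\<in>{..k}. top_fibre (Suc k) d)"
  proof (cases "\<alpha> (Suc k)")
    case None
    have bd: "1 \<le> y \<and> y \<le> x \<and> x \<le> k" if "\<alpha> x = Some y" for x y
      using DDP_D[OF D that] that None by (cases "x = Suc k") auto
    have "dom \<alpha> \<subseteq> {1..k}" using bd by fastforce
    moreover have "ran \<alpha> \<subseteq> {1..k}" using bd by (fastforce simp: ran_def)
    ultimately have "\<alpha> \<in> DDP k"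
      using D by (simp add: DDP_def sym_inv_semigroup_def X_set_def)
    then show ?thesis by blast
  next
    case (Some y)
    then have "1 \<le> y" "y \<le> Suc k" using DDP_D[OF D Some] by auto
    then have "Suc k - y \<le> k" "y = Suc k - (Suc k - y)" by auto
    then show ?thesis using D Some by (auto simp: top_fibre_def)
  qed
next
  fix \<alpha> assume "\<alpha> \<in> DDP k \<union> (\<Union>d\<in>{..k}. top_fibre (Suc k) d)"
  then show "\<alpha> \<in> DDP (Suc k)"
    by (fastforce simp: top_fibre_def DDP_def sym_inv_semigroup_def X_set_def)
qed

lemma finite_DDP: "finite (DDP k)"
  by (induction k) (simp_all add: DDP_0 DDP_Suc finite_top_fibre)

lemma sum_powers_of_two: "(\<Sum>d\<le>k. 2 ^ (k - d) :: int) = 2 ^ Suc k - 1"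
  by (induction k) (simp_all add: sum.atMost_Suc_shift del: sum.atMost_Suc)

lemma card_DDP_Suc:
  "int (card (DDP (Suc k))) = int (card (DDP k)) + 2 ^ Suc k - 2 - int k + (\<Sum>d\<le>k. 2 ^ (d div 2))"
proof -
  have disj: "DDP k \<inter> (\<Union>d\<in>{..k}. top_fibre (Suc k) d) = {}"
    using DDP_D(2)[of _ k "Suc k"] by (fastforce simp: top_fibre_def)
  have "card (\<Union>d\<in>{..k}. top_fibre (Suc k) d) = (\<Sum>d\<le>k. card (top_fibre (Suc k) d))"
  proof (rule card_UN_disjoint)
    show "\<forall>d\<in>{..k}. \<forall>e\<in>{..k}. d \<noteq> e \<longrightarrow> top_fibre (Suc k) d \<inter> top_fibre (Suc k) e = {}"
      by (auto simp: top_fibre_def)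
  qed (auto simp: finite_top_fibre)
  then have "card (DDP (Suc k)) = card (DDP k) + (\<Sum>d\<le>k. card (top_fibre (Suc k) d))"
    unfolding DDP_Suc
    by (subst card_Un_disjoint[OF _ _ disj]) (simp_all add: finite_DDP finite_top_fibre)
  then have "int (card (DDP (Suc k)))
      = int (card (DDP k)) + (\<Sum>d\<le>k. 2 ^ (k - d) + 2 ^ (d div 2) - 1)"
    by (simp add: card_top_fibre)
  then show ?thesis
    by (simp add: sum.distrib sum_subtractf sum_powers_of_two)
qed

lemma sum_powers_half:
  "(\<Sum>d\<le>2 * n. 2 ^ (d div 2) :: int) = 3 * 2 ^ n - 2"
  "(\<Sum>d\<le>2 * n + 1. 2 ^ (d div 2) :: int) = 4 * 2 ^ n - 2"
  by (induction n) simp_all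

theorem theorem2p17:
  fixes n :: nat
  shows "int (card (DDP (2 * n + 1))) =
           2 ^ (2 * n + 2) + 5 * 2 ^ (n + 1) - (2 * (int n) ^ 2 + 9 * int n + 12)
    \<and> int (card (DDP (2 * n))) =
           2 ^ (2 * n + 1) + 7 * 2 ^ n - (2 * (int n) ^ 2 + 7 * int n + 8)"
proof -
  \<comment> \<open>The recurrence leads from each even index to the next odd one and on to the next even one, so
    the induction runs over the even case and the odd formula is a single step of it.\<close>
  have odd: "int (card (DDP (2 * m + 1))) =
      2 ^ (2 * m + 2) + 5 * 2 ^ (m + 1) - (2 * (int m) ^ 2 + 9 * int m + 12)"
    if "int (card (DDP (2 * m))) =
      2 ^ (2 * m + 1) + 7 * 2 ^ m - (2 * (int m) ^ 2 + 7 * int m + 8)" for m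
    using card_DDP_Suc[of "2 * m"] that by (simp add: sum_powers_half)
  have even: "int (card (DDP (2 * n))) =
      2 ^ (2 * n + 1) + 7 * 2 ^ n - (2 * (int n) ^ 2 + 7 * int n + 8)"
  proof (induction n)
    case 0
    show ?case by (simp add: DDP_0)
  next
    case (Suc n)
    show ?case
      using card_DDP_Suc[of "2 * n + 1"] odd[OF Suc] sum_powers_half(2)[of n]
      by (simp add: power2_eq_square algebra_simps)
  qed
  from odd[OF even] even show ?thesis ..
qed

end
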